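(* Let $F$ be a finitely generated free group, and let $N\subseteq N_1$ be normal subgroups of $F$. Let $P=F/N$ and $P_1=N_1/N$. Assume that $F/N$ is weakly sofic and $F/N_1$ is residually finite. Then $P$ embeds into a metric ultraproduct of finite groups equipped with invariant length functions (norms) $\le 1$, in such a way that $P_1$ consists exactly of all elements of $P$ whose norm in that ultraproduct is $\le\frac12$.
   Context: A length function on a group $G$ is $l:G\to[0,\infty)$ with $l(g)=0$ if and only if $g=1$, $l(g)=l(g^{-1})$, and $l(gh)\le l(g)+l(h)$; it is invariant if $l(h^{-1}gh)=l(g)$ for all $g,h\in G$. Metric ultraproduct: for a family $(G_i,l_i)_{i\in I}$ of groups with invariant length functions bounded by a common constant, and an ultrafilter $\Phi$ on $I$, let $N_\Phi=\{(x_i)\in\prod_I G_i:\lim_{i\to\Phi}l_i(x_i)=0\}$; the metric ultraproduct is $(\prod_I G_i)/N_\Phi$ with length function (norm) $l((x_i)N_\Phi)=\lim_{i\to\Phi}l_i(x_i)$. A group is weakly sofic if it embeds (as an abstract group) into a metric ultraproduct of finite groups with invariant length functions. Here the length functions need not be uniformly bounded; replacing each $l_i$ by $l_i/(1+l_i)$ one may take them bounded by $1$ without changing the ultraproduct as a group. *)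

theory Defs
  imports Complex_Main "HOL-Algebra.Generated_Groups" "HOL-Algebra.Product_Groups"
begin

section \<open>Finitely generated free groups\<close>

text \<open>
  A word over \<open>S\<close> and its formal inverses is a list of letters; \<open>(s, True)\<close> stands for \<open>s\<close> and
  \<open>(s, False)\<close> for its inverse.
\<close>

fun word_value :: "('a, 'b) monoid_scheme \<Rightarrow> ('a \<times> bool) list \<Rightarrow> 'a" where
  "word_value G [] = \<one>\<^bsub>G\<^esub>"
| "word_value G ((s, b) # w) = (if b then s else inv\<^bsub>G\<^esub> s) \<otimes>\<^bsub>G\<^esub> word_value G w"

definition reduced_word :: "('a \<times> bool) list \<Rightarrow> bool" where
  "reduced_word w \<longleftrightarrow> successively (\<lambda>(s, b) (t, c). \<not> (s = t \<and> b \<noteq> c)) w"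

definition free_basis :: "('a, 'b) monoid_scheme \<Rightarrow> 'a set \<Rightarrow> bool" where
  "free_basis G S \<longleftrightarrow> S \<subseteq> carrier G \<and>
     (\<forall>g\<in>carrier G. \<exists>!w. w \<in> lists (S \<times> UNIV) \<and> reduced_word w \<and> word_value G w = g)"

definition free_group :: "('a, 'b) monoid_scheme \<Rightarrow> bool" where
  "free_group G \<longleftrightarrow> group G \<and> (\<exists>S. free_basis G S)"

definition finitely_generated_group :: "('a, 'b) monoid_scheme \<Rightarrow> bool" where
  "finitely_generated_group G \<longleftrightarrow>
     group G \<and> (\<exists>A. finite A \<and> A \<subseteq> carrier G \<and> generate G A = carrier G)"

section \<open>Residually finite groups\<close>

definition residually_finite :: "('a, 'b) monoid_scheme \<Rightarrow> bool" where
  "residually_finite G \<longleftrightarrow> group G \<and>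
     (\<forall>g\<in>carrier G. g \<noteq> \<one>\<^bsub>G\<^esub> \<longrightarrow> (\<exists>K. K \<lhd> G \<and> finite (carrier (G Mod K)) \<and> g \<notin> K))"

section \<open>Length functions\<close>

locale length_function = group G for G :: "('a, 'b) monoid_scheme" (structure) +
  fixes l :: "'a \<Rightarrow> real"
  assumes length_nonneg: "g \<in> carrier G \<Longrightarrow> 0 \<le> l g"
    and length_eq_0_iff: "g \<in> carrier G \<Longrightarrow> l g = 0 \<longleftrightarrow> g = \<one>"
    and length_inv: "g \<in> carrier G \<Longrightarrow> l (inv g) = l g"
    and length_mult: "g \<in> carrier G \<Longrightarrow> h \<in> carrier G \<Longrightarrow> l (g \<otimes> h) \<le> l g + l h"

locale invariant_length_function = length_function +
  assumes length_conj: "g \<in> carrier G \<Longrightarrow> h \<in> carrier G \<Longrightarrow> l (inv h \<otimes> g \<otimes> h) = l g"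

section \<open>Metric ultraproducts\<close>

text \<open>
  An ultrafilter on the set \<open>I\<close> is encoded as a filter on the ambient type that is concentrated
  on \<open>I\<close>.  Limits along it are then the library's limits along a filter.
\<close>

definition ultrafilter_on :: "'i set \<Rightarrow> 'i filter \<Rightarrow> bool" where
  "ultrafilter_on I \<Phi> \<longleftrightarrow> \<Phi> \<le> principal I \<and> \<Phi> \<noteq> bot \<and>
     (\<forall>A\<subseteq>I. eventually (\<lambda>i. i \<in> A) \<Phi> \<or> eventually (\<lambda>i. i \<in> I - A) \<Phi>)"

definition null_subgroup ::
    "'i set \<Rightarrow> ('i \<Rightarrow> ('a, 'b) monoid_scheme) \<Rightarrow> ('i \<Rightarrow> 'a \<Rightarrow> real) \<Rightarrow> 'i filter \<Rightarrow> ('i \<Rightarrow> 'a) set" where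
  "null_subgroup I G l \<Phi> =
     {x \<in> carrier (product_group I G). ((\<lambda>i. l i (x i)) \<longlongrightarrow> 0) \<Phi>}"

definition metric_ultraproduct ::
    "'i set \<Rightarrow> ('i \<Rightarrow> ('a, 'b) monoid_scheme) \<Rightarrow> ('i \<Rightarrow> 'a \<Rightarrow> real) \<Rightarrow> 'i filter \<Rightarrow> ('i \<Rightarrow> 'a) set monoid" where
  "metric_ultraproduct I G l \<Phi> = product_group I G Mod null_subgroup I G l \<Phi>"

text \<open>
  The norm of a coset is the common limit of the lengths of its representatives.  It exists and
  is unique when the lengths are uniformly bounded; see \<open>ultraproduct_norm_unique\<close> and
  \<open>ultraproduct_norm_tendsto\<close> below.
\<close>

definition ultraproduct_norm ::
    "('i \<Rightarrow> 'a \<Rightarrow> real) \<Rightarrow> 'i filter \<Rightarrow> ('i \<Rightarrow> 'a) set \<Rightarrow> real" where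
  "ultraproduct_norm l \<Phi> C = (THE r. \<forall>x\<in>C. ((\<lambda>i. l i (x i)) \<longlongrightarrow> r) \<Phi>)"

section \<open>Weakly sofic groups\<close>

text \<open>
  HOL cannot quantify existentially over the type of the indices and the type of the elements of
  the finite groups, so both are parameters.  Where \<open>weakly_sofic\<close> is assumed with type variables
  as parameters, every choice of index set and of finite groups is covered.  The length functions
  are not required to be bounded.
\<close>

definition weakly_sofic ::
    "'i itself \<Rightarrow> 'g itself \<Rightarrow> ('a, 'b) monoid_scheme \<Rightarrow> bool" where
  "weakly_sofic (_ :: 'i itself) (_ :: 'g itself) P \<longleftrightarrow> group P \<and>
     (\<exists>(I :: 'i set) (H :: 'i \<Rightarrow> 'g monoid) l \<Phi> \<phi>.
        ultrafilter_on I \<Phi> \<and>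
        (\<forall>i\<in>I. finite (carrier (H i)) \<and> invariant_length_function (H i) (l i)) \<and>
        \<phi> \<in> mon P (metric_ultraproduct I H l \<Phi>))"

section \<open>Metric ultraproducts are well defined\<close>

lemma ultrafilter_on_eventually_mem:
  assumes "ultrafilter_on I \<Phi>" shows "eventually (\<lambda>i. i \<in> I) \<Phi>"
  using assms by (auto simp: ultrafilter_on_def le_principal)

lemma normal_null_subgroup:
  assumes U: "ultrafilter_on I \<Phi>"
    and L: "\<And>i. i \<in> I \<Longrightarrow> invariant_length_function (G i) (l i)"
  shows "null_subgroup I G l \<Phi> \<lhd> product_group I G"
proof -
  let ?P = "product_group I G" and ?N = "null_subgroup I G l \<Phi>"
  have g: "group (G i)" if "i \<in> I" for i
    using L[OF that] by (simp add: invariant_length_function_def length_function_def)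
  have lf: "length_function (G i) (l i)" if "i \<in> I" for i
    using L[OF that] by (simp add: invariant_length_function_def)
  interpret P: group ?P using g by simp
  note ev = ultrafilter_on_eventually_mem[OF U]
  have invP: "(inv\<^bsub>?P\<^esub> x) i = inv\<^bsub>G i\<^esub> (x i)" if "x \<in> carrier ?P" "i \<in> I" for x i
    using inv_product_group[of x I G] that g by simp
  have "subgroup ?N ?P"
  proof (rule P.subgroupI)
    show "?N \<subseteq> carrier ?P" by (auto simp: null_subgroup_def)
    have "((\<lambda>i. l i (\<one>\<^bsub>?P\<^esub> i)) \<longlongrightarrow> 0) \<Phi>"
    proof (rule tendsto_eventually, rule eventually_mono[OF ev])
      fix i assume i: "i \<in> I"
      interpret length_function "G i" "l i" by (rule lf[OF i])
      show "l i (\<one>\<^bsub>?P\<^esub> i) = 0" using i length_eq_0_iff[of "\<one>\<^bsub>G i\<^esub>"] by simp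
    qed
    then have "\<one>\<^bsub>?P\<^esub> \<in> ?N" unfolding null_subgroup_def using P.one_closed by blast
    then show "?N \<noteq> {}" by blast
  next
    fix x assume "x \<in> ?N"
    then have x: "x \<in> carrier ?P" and t: "((\<lambda>i. l i (x i)) \<longlongrightarrow> 0) \<Phi>"
      by (auto simp: null_subgroup_def)
    have e: "eventually (\<lambda>i. l i (x i) = l i ((inv\<^bsub>?P\<^esub> x) i)) \<Phi>"
    proof (rule eventually_mono[OF ev])
      fix i assume i: "i \<in> I"
      interpret length_function "G i" "l i" by (rule lf[OF i])
      show "l i (x i) = l i ((inv\<^bsub>?P\<^esub> x) i)" 
        unfolding invP[OF x i] using x i by (subst length_inv) auto
    qed
    have "((\<lambda>i. l i ((inv\<^bsub>?P\<^esub> x) i)) \<longlongrightarrow> 0) \<Phi>" by (rule Lim_transform_eventually[OF t e])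
    then show "inv\<^bsub>?P\<^esub> x \<in> ?N" unfolding null_subgroup_def using P.inv_closed[OF x] by blast
  next
    fix x y assume "x \<in> ?N" "y \<in> ?N"
    then have x: "x \<in> carrier ?P" and t: "((\<lambda>i. l i (x i)) \<longlongrightarrow> 0) \<Phi>"
      and y: "y \<in> carrier ?P" and s: "((\<lambda>i. l i (y i)) \<longlongrightarrow> 0) \<Phi>"
      by (auto simp: null_subgroup_def)
    have "eventually (\<lambda>i. 0 \<le> l i ((x \<otimes>\<^bsub>?P\<^esub> y) i) \<and> l i ((x \<otimes>\<^bsub>?P\<^esub> y) i) \<le> l i (x i) + l i (y i)) \<Phi>"
    proof (rule eventually_mono[OF ev])
      fix i assume i: "i \<in> I"
      interpret length_function "G i" "l i" by (rule lf[OF i])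
      have "x i \<in> carrier (G i)" "y i \<in> carrier (G i)" using x y i by auto
      then show "0 \<le> l i ((x \<otimes>\<^bsub>?P\<^esub> y) i) \<and> l i ((x \<otimes>\<^bsub>?P\<^esub> y) i) \<le> l i (x i) + l i (y i)"
        using i by (simp add: length_nonneg length_mult)
    qed
    then have e1: "eventually (\<lambda>i. 0 \<le> l i ((x \<otimes>\<^bsub>?P\<^esub> y) i)) \<Phi>"
      and e2: "eventually (\<lambda>i. l i ((x \<otimes>\<^bsub>?P\<^esub> y) i) \<le> l i (x i) + l i (y i)) \<Phi>"
      unfolding eventually_conj_iff by blast+
    have "((\<lambda>i. l i (x i) + l i (y i)) \<longlongrightarrow> 0) \<Phi>" using tendsto_add[OF t s] by simp
    then have "((\<lambda>i. l i ((x \<otimes>\<^bsub>?P\<^esub> y) i)) \<longlongrightarrow> 0) \<Phi>"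
      by (rule tendsto_sandwich[OF e1 e2 tendsto_const])
    then show "x \<otimes>\<^bsub>?P\<^esub> y \<in> ?N"
      unfolding null_subgroup_def using P.m_closed[OF x y] by blast
  qed
  moreover have "\<forall>z\<in>carrier ?P. \<forall>x\<in>?N. z \<otimes>\<^bsub>?P\<^esub> x \<otimes>\<^bsub>?P\<^esub> inv\<^bsub>?P\<^esub> z \<in> ?N"
  proof (intro ballI)
    fix z x assume z: "z \<in> carrier ?P" and "x \<in> ?N"
    then have x: "x \<in> carrier ?P" and t: "((\<lambda>i. l i (x i)) \<longlongrightarrow> 0) \<Phi>"
      by (auto simp: null_subgroup_def)
    have e: "eventually (\<lambda>i. l i (x i) = l i ((z \<otimes>\<^bsub>?P\<^esub> x \<otimes>\<^bsub>?P\<^esub> inv\<^bsub>?P\<^esub> z) i)) \<Phi>"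
    proof (rule eventually_mono[OF ev])
      fix i assume i: "i \<in> I"
      interpret invariant_length_function "G i" "l i" by (rule L[OF i])
      have c: "x i \<in> carrier (G i)" "z i \<in> carrier (G i)" using x z i by auto
      then show "l i (x i) = l i ((z \<otimes>\<^bsub>?P\<^esub> x \<otimes>\<^bsub>?P\<^esub> inv\<^bsub>?P\<^esub> z) i)"
        using length_conj[of "x i" "inv\<^bsub>G i\<^esub> (z i)"] i invP[OF z i] by simp
    qed
    have "((\<lambda>i. l i ((z \<otimes>\<^bsub>?P\<^esub> x \<otimes>\<^bsub>?P\<^esub> inv\<^bsub>?P\<^esub> z) i)) \<longlongrightarrow> 0) \<Phi>"
      by (rule Lim_transform_eventually[OF t e])
    then show "z \<otimes>\<^bsub>?P\<^esub> x \<otimes>\<^bsub>?P\<^esub> inv\<^bsub>?P\<^esub> z \<in> ?N"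
      unfolding null_subgroup_def using x z P.m_closed P.inv_closed by blast
  qed
  ultimately show ?thesis by (simp add: P.normal_inv_iff)
qed

lemma ultrafilter_on_bounded_tendsto:
  fixes f :: "'i \<Rightarrow> real"
  assumes U: "ultrafilter_on I \<Phi>" and B: "\<And>i. i \<in> I \<Longrightarrow> a \<le> f i \<and> f i \<le> b"
  obtains r where "(f \<longlongrightarrow> r) \<Phi>"
proof -
  note ev = ultrafilter_on_eventually_mem[OF U]
  have nb: "\<Phi> \<noteq> bot" using U by (simp add: ultrafilter_on_def)
  have dich: "eventually Q \<Phi> \<or> eventually (\<lambda>i. \<not> Q i) \<Phi>" for Q
  proof -
    have "eventually (\<lambda>i. i \<in> {i \<in> I. Q i}) \<Phi> \<or> eventually (\<lambda>i. i \<in> I - {i \<in> I. Q i}) \<Phi>"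
      using U unfolding ultrafilter_on_def by (elim conjE allE[of _ "{i \<in> I. Q i}"]) simp
    then show ?thesis
    proof
      assume "eventually (\<lambda>i. i \<in> {i \<in> I. Q i}) \<Phi>"
      then have "eventually Q \<Phi>" by (rule eventually_mono) simp
      then show ?thesis ..
    next
      assume "eventually (\<lambda>i. i \<in> I - {i \<in> I. Q i}) \<Phi>"
      then have "eventually (\<lambda>i. \<not> Q i) \<Phi>" by (rule eventually_mono) simp
      then show ?thesis ..
    qed
  qed
  define T where "T = {t. eventually (\<lambda>i. t \<le> f i) \<Phi>}"
  have "eventually (\<lambda>i. a \<le> f i) \<Phi>" by (rule eventually_mono[OF ev]) (use B in blast)
  then have ne: "T \<noteq> {}" by (auto simp: T_def)
  have ub: "t \<le> b" if "t \<in> T" for t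
  proof -
    have "eventually (\<lambda>i. t \<le> f i \<and> i \<in> I) \<Phi>"
      using that ev unfolding T_def mem_Collect_eq by (rule eventually_conj)
    then obtain i where "t \<le> f i" "i \<in> I" using eventually_happens'[OF nb] by blast
    then show ?thesis using B by fastforce
  qed
  have bdd: "bdd_above T" using ub by (auto simp: bdd_above_def)
  have "(f \<longlongrightarrow> Sup T) \<Phi>"
  proof (rule order_tendstoI)
    fix c assume "c < Sup T"
    then obtain t where "t \<in> T" "c < t" using less_cSup_iff[OF ne bdd] by blast
    then have "eventually (\<lambda>i. t \<le> f i) \<Phi>" by (simp add: T_def)
    then show "eventually (\<lambda>i. c < f i) \<Phi>" by (rule eventually_mono) (use \<open>c < t\<close> in simp)
  next
    fix c assume "Sup T < c"
    then have "c \<notin> T" using cSup_upper[OF _ bdd] by fastforce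
    then have "eventually (\<lambda>i. \<not> c \<le> f i) \<Phi>" using dich by (auto simp: T_def)
    then show "eventually (\<lambda>i. f i < c) \<Phi>" by (simp add: not_le)
  qed
  then show ?thesis by (rule that)
qed

lemma ultraproduct_norm_unique:
  assumes U: "ultrafilter_on I \<Phi>"
    and L: "\<And>i. i \<in> I \<Longrightarrow> invariant_length_function (G i) (l i)"
    and x: "x \<in> carrier (product_group I G)"
    and t: "((\<lambda>i. l i (x i)) \<longlongrightarrow> r) \<Phi>"
  shows "ultraproduct_norm l \<Phi> (null_subgroup I G l \<Phi> #>\<^bsub>product_group I G\<^esub> x) = r"
proof -
  let ?P = "product_group I G" and ?N = "null_subgroup I G l \<Phi>"
  have lf: "length_function (G i) (l i)" if "i \<in> I" for i
    using L[OF that] by (simp add: invariant_length_function_def)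
  have g: "group (G i)" if "i \<in> I" for i
    using lf[OF that] by (simp add: length_function_def)
  interpret P: group ?P using g by simp
  interpret N: normal ?N ?P by (rule normal_null_subgroup[OF U L])
  note ev = ultrafilter_on_eventually_mem[OF U]
  have self: "x \<in> ?N #>\<^bsub>?P\<^esub> x" using x by (rule P.rcos_self) (rule N.subgroup_axioms)
  have all: "((\<lambda>i. l i (y i)) \<longlongrightarrow> r) \<Phi>" if "y \<in> ?N #>\<^bsub>?P\<^esub> x" for y
  proof -
    from that obtain n where n: "n \<in> ?N" and y: "y = n \<otimes>\<^bsub>?P\<^esub> x" by (auto simp: r_coset_def)
    have nc: "n \<in> carrier ?P" and nt: "((\<lambda>i. l i (n i)) \<longlongrightarrow> 0) \<Phi>"
      using n by (auto simp: null_subgroup_def)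
    have "eventually (\<lambda>i. l i (x i) - l i (n i) \<le> l i (y i) \<and> l i (y i) \<le> l i (n i) + l i (x i)) \<Phi>"
    proof (rule eventually_mono[OF ev])
      fix i assume i: "i \<in> I"
      interpret length_function "G i" "l i" by (rule lf[OF i])
      have c: "n i \<in> carrier (G i)" "x i \<in> carrier (G i)" using nc x i by auto
      have yi: "y i = n i \<otimes>\<^bsub>G i\<^esub> x i" using i by (simp add: y)
      have "x i = inv\<^bsub>G i\<^esub> (n i) \<otimes>\<^bsub>G i\<^esub> y i" using c by (simp add: yi m_assoc[symmetric])
      then have "l i (x i) \<le> l i (n i) + l i (y i)"
        using length_mult[of "inv\<^bsub>G i\<^esub> (n i)" "y i"] length_inv[of "n i"] c by (simp add: yi)
      then show "l i (x i) - l i (n i) \<le> l i (y i) \<and> l i (y i) \<le> l i (n i) + l i (x i)"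
        using length_mult c by (simp add: yi)
    qed
    then have e1: "eventually (\<lambda>i. l i (x i) - l i (n i) \<le> l i (y i)) \<Phi>"
      and e2: "eventually (\<lambda>i. l i (y i) \<le> l i (n i) + l i (x i)) \<Phi>"
      unfolding eventually_conj_iff by blast+
    have "((\<lambda>i. l i (x i) - l i (n i)) \<longlongrightarrow> r) \<Phi>" using tendsto_diff[OF t nt] by simp
    moreover have "((\<lambda>i. l i (n i) + l i (x i)) \<longlongrightarrow> r) \<Phi>" using tendsto_add[OF nt t] by simp
    ultimately show ?thesis by (rule tendsto_sandwich[OF e1 e2])
  qed
  have "\<Phi> \<noteq> bot" using U by (simp add: ultrafilter_on_def)
  then show ?thesis
    unfolding ultraproduct_norm_def
    using all self t by (intro the_equality ballI) (auto intro: tendsto_unique)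
qed

lemma ultraproduct_norm_tendsto:
  assumes U: "ultrafilter_on I \<Phi>"
    and L: "\<And>i. i \<in> I \<Longrightarrow> invariant_length_function (G i) (l i)"
    and B: "\<And>i g. i \<in> I \<Longrightarrow> g \<in> carrier (G i) \<Longrightarrow> l i g \<le> C"
    and x: "x \<in> carrier (product_group I G)"
  shows "((\<lambda>i. l i (x i)) \<longlongrightarrow>
           ultraproduct_norm l \<Phi> (null_subgroup I G l \<Phi> #>\<^bsub>product_group I G\<^esub> x)) \<Phi>"
proof -
  have "0 \<le> l i (x i) \<and> l i (x i) \<le> C" if i: "i \<in> I" for i
  proof -
    interpret invariant_length_function "G i" "l i" by (rule L[OF i])
    have "x i \<in> carrier (G i)" using x i by auto
    then show ?thesis using B[OF i] length_nonneg by simp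
  qed
  then obtain r where r: "((\<lambda>i. l i (x i)) \<longlongrightarrow> r) \<Phi>"
    by (rule ultrafilter_on_bounded_tendsto[OF U])
  then show ?thesis using ultraproduct_norm_unique[OF U L x r] by simp
qed

end

theory Submission
  imports Defs "HOL-Library.Countable_Set"
begin

text \<open>
  A weakly sofic group embeds into an ultraproduct of finite groups \<open>H\<close> whose length functions may
  be truncated at \<open>1 / 2\<close>: truncation keeps them invariant length functions and does not change
  which sequences tend to \<open>0\<close>.  Let \<open>\<pi>\<close> be the projection of \<open>F/N\<close> onto the residually finite group
  \<open>F/N1\<close>.  On the product of \<open>H\<close> with a finite quotient \<open>R\<close> of \<open>F/N1\<close>, give \<open>(h, q)\<close> the truncated
  length of \<open>h\<close> if \<open>q = 1\<close> and the length \<open>1\<close> otherwise.  The triangle inequality survives, because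
  two elements of length \<open>1\<close> leave room for any product, and a product of two elements with \<open>q = 1\<close>
  again has \<open>q = 1\<close> (\<open>invariant_length_function_DirProd\<close>).  Mapping \<open>p\<close> to its image in \<open>H\<close>
  paired with the image of \<open>\<pi> p\<close> in \<open>R\<close>, and letting \<open>R\<close> separate more and more of \<open>F/N1\<close> from the
  identity, gives \<open>p\<close> the limit norm \<open>1\<close> if \<open>\<pi> p \<noteq> 1\<close>, and a norm at most \<open>1 / 2\<close> if \<open>\<pi> p = 1\<close>.
  The kernel of \<open>\<pi>\<close> is \<open>N1/N\<close>, so this is the required embedding.

  The two limits, along the given ultrafilter and along the quotients, are merged by passing through
  finite approximations.  An embedding into an ultraproduct restricts, for every finite set \<open>E\<close> and
  every \<open>\<epsilon> > 0\<close>, to a map into a single finite group that is multiplicative on \<open>E\<close> and has the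
  limit lengths on \<open>E\<close>, both up to \<open>\<epsilon>\<close> (\<open>weakly_sofic_finite_models\<close>).  The quotient \<open>R\<close> then only
  has to separate the finitely many elements of \<open>\<pi> ` E\<close>.  Conversely, for a countable group such
  models along an exhaustion, with \<open>\<epsilon>\<close> tending to \<open>0\<close>, assemble to an embedding into an ultraproduct
  over the natural numbers (\<open>ultraproduct_of_finite_models\<close>).  A finitely generated group is
  countable, and finite groups have isomorphic copies on the natural numbers.
\<close>

section \<open>Ultrafilters\<close>

text \<open>
  An ultrafilter on \<open>I\<close> is a minimal proper filter below the principal filter of \<open>I\<close>, and Zorn's
  lemma gives one: the infimum of a nonempty chain of proper filters is proper because an event of
  the infimum of a chain is already an event of one of its members.
\<close>

lemma ultrafilter_below:
  assumes ne: "F \<noteq> bot" and FI: "F \<le> principal I"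
  obtains \<Phi> where "ultrafilter_on I \<Phi>" "\<Phi> \<le> F"
proof -
  define \<A> where "\<A> = {G. G \<le> F \<and> G \<noteq> bot}"
  define P where "P = (\<lambda>G H :: 'a filter. H \<le> G)"
  have "\<exists>M\<in>\<A>. \<forall>G\<in>\<A>. P M G \<longrightarrow> G = M"
  proof (rule predicate_Zorn)
    show "partial_order_on \<A> (relation_of P \<A>)"
      by (rule partial_order_on_relation_ofI) (auto simp: P_def)
    fix \<C> assume C: "\<C> \<in> Chains (relation_of P \<A>)"
    then have sub: "\<C> \<subseteq> \<A>" and chain: "\<And>G H. G \<in> \<C> \<Longrightarrow> H \<in> \<C> \<Longrightarrow> H \<le> G \<or> G \<le> H"
      by (auto simp: Chains_def relation_of_def P_def)
    show "\<exists>U\<in>\<A>. \<forall>G\<in>\<C>. P G U"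
    proof (cases "\<C> = {}")
      case True
      then show ?thesis using ne by (auto simp: \<A>_def)
    next
      case False
      have "Inf \<C> \<noteq> bot"
      proof
        assume "Inf \<C> = bot"
        then have "eventually (\<lambda>_. False) (Inf \<C>)" by simp
        moreover have "eventually (\<lambda>_. False) (Inf \<C>) \<longleftrightarrow> (\<exists>G\<in>\<C>. eventually (\<lambda>_. False) G)"
        proof (rule eventually_Inf_base[OF False])
          fix G H assume "G \<in> \<C>" "H \<in> \<C>"
          then show "\<exists>x\<in>\<C>. x \<le> inf G H" using chain[of G H] by (metis inf.absorb1 inf.absorb2 order_refl)
        qed
        ultimately obtain G where "G \<in> \<C>" "eventually (\<lambda>_. False) G" by blast
        then show False using sub by (auto simp: \<A>_def trivial_limit_def)
      qed
      moreover have "Inf \<C> \<le> F" using False sub by (auto simp: \<A>_def intro: Inf_lower2)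
      ultimately show ?thesis by (auto simp: \<A>_def P_def intro: Inf_lower)
    qed
  qed
  then obtain M where M: "M \<le> F" "M \<noteq> bot"
    and max: "\<And>G. G \<le> F \<Longrightarrow> G \<noteq> bot \<Longrightarrow> G \<le> M \<Longrightarrow> G = M"
    by (auto simp: \<A>_def P_def)
  have MI: "M \<le> principal I" using M(1) FI by (rule order_trans)
  have "eventually (\<lambda>i. i \<in> A) M \<or> eventually (\<lambda>i. i \<in> I - A) M" if "A \<subseteq> I" for A
  proof (cases "inf M (principal (I - A)) = bot")
    case True
    then have "eventually (\<lambda>i. i \<notin> I - A) M"
      by (simp add: trivial_limit_def eventually_inf_principal)
    moreover have "eventually (\<lambda>i. i \<in> I) M" using MI by (simp add: le_principal)
    ultimately have "eventually (\<lambda>i. i \<in> A) M" by eventually_elim simp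
    then show ?thesis ..
  next
    case False
    then have "inf M (principal (I - A)) = M" using M(1) by (intro max) (auto intro: le_infI1)
    then have "M \<le> principal (I - A)" by (metis inf.cobounded2)
    then show ?thesis by (simp add: le_principal)
  qed
  then have "ultrafilter_on I M" using MI M(2) by (simp add: ultrafilter_on_def)
  then show ?thesis using M(1) that by blast
qed

section \<open>Length functions\<close>

lemma invariant_length_function_min:
  assumes "invariant_length_function G l" and c: "0 < c"
  shows "invariant_length_function G (\<lambda>g. min (l g) c)"
proof -
  interpret invariant_length_function G l by fact
  show ?thesis
  proof (unfold_locales)
    fix g assume g: "g \<in> carrier G"
    show "0 \<le> min (l g) c" "min (l g) c = 0 \<longleftrightarrow> g = \<one>\<^bsub>G\<^esub>" "min (l (inv\<^bsub>G\<^esub> g)) c = min (l g) c"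
      using length_nonneg[OF g] length_eq_0_iff[OF g] length_inv[OF g] c by (auto simp: min_def)
    fix h assume h: "h \<in> carrier G"
    show "min (l (g \<otimes>\<^bsub>G\<^esub> h)) c \<le> min (l g) c + min (l h) c"
      using length_mult[OF g h] length_nonneg[OF g] length_nonneg[OF h] c by (auto simp: min_def)
    show "min (l (inv\<^bsub>G\<^esub> h \<otimes>\<^bsub>G\<^esub> g \<otimes>\<^bsub>G\<^esub> h)) c = min (l g) c" using length_conj[OF g h] by simp
  qed
qed

lemma invariant_length_function_mon:
  assumes "invariant_length_function G l" and R: "group R" and k: "k \<in> mon R G"
  shows "invariant_length_function R (\<lambda>x. l (k x))"
proof -
  interpret G: invariant_length_function G l by fact
  interpret R: group R by fact
  interpret k: group_hom R G k
    using k by unfold_locales (simp add: mon_def)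
  have inj: "k x = \<one>\<^bsub>G\<^esub> \<longleftrightarrow> x = \<one>\<^bsub>R\<^esub>" if "x \<in> carrier R" for x
    using k that k.inj_on_one_iff by (auto simp: mon_def)
  show ?thesis
    by unfold_locales
      (simp_all add: G.length_nonneg G.length_eq_0_iff G.length_inv G.length_mult G.length_conj inj)
qed

text \<open>
  Outside the subgroup \<open>q = 1\<close> the length is the maximal value \<open>1\<close>.  The only delicate instance of
  the triangle inequality is a product with \<open>q = 1\<close> of two elements outside the subgroup; there the
  right hand side is \<open>2\<close>.  The bound \<open>1 / 2\<close> leaves a gap below \<open>1\<close>, so that the norm recognises the
  subgroup even after a limit.
\<close>

lemma invariant_length_function_DirProd:
  assumes "invariant_length_function H l" and R: "group R"
    and half: "\<And>h. h \<in> carrier H \<Longrightarrow> l h \<le> 1 / 2"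
  shows "invariant_length_function (H \<times>\<times> R) (\<lambda>(h, q). if q = \<one>\<^bsub>R\<^esub> then l h else 1)"
proof -
  interpret H: invariant_length_function H l by fact
  interpret R: group R by fact
  interpret D: group "H \<times>\<times> R" by (rule DirProd_group) unfold_locales
  show ?thesis
  proof (unfold_locales)
    fix x assume "x \<in> carrier (H \<times>\<times> R)"
    then obtain g p where x: "x = (g, p)" and g: "g \<in> carrier H" and p: "p \<in> carrier R" by auto
    let ?l = "\<lambda>(h, q). if q = \<one>\<^bsub>R\<^esub> then l h else 1"
    show "0 \<le> ?l x" using H.length_nonneg[OF g] by (simp add: x)
    show "?l x = 0 \<longleftrightarrow> x = \<one>\<^bsub>H \<times>\<times> R\<^esub>" using H.length_eq_0_iff[OF g] by (simp add: x)
    show "?l (inv\<^bsub>H \<times>\<times> R\<^esub> x) = ?l x" using H.length_inv[OF g] g p by (simp add: x H.is_group R.is_group)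
    fix y assume "y \<in> carrier (H \<times>\<times> R)"
    then obtain h q where y: "y = (h, q)" and h: "h \<in> carrier H" and q: "q \<in> carrier R" by auto
    show "?l (x \<otimes>\<^bsub>H \<times>\<times> R\<^esub> y) \<le> ?l x + ?l y"
      using H.length_mult[OF g h] H.length_nonneg[OF g] H.length_nonneg[OF h] half[of "g \<otimes>\<^bsub>H\<^esub> h"] g h p q
      by (auto simp: x y)
    have "inv\<^bsub>R\<^esub> q \<otimes>\<^bsub>R\<^esub> p \<otimes>\<^bsub>R\<^esub> q = \<one>\<^bsub>R\<^esub> \<longleftrightarrow> p = \<one>\<^bsub>R\<^esub>"
    proof
      assume "inv\<^bsub>R\<^esub> q \<otimes>\<^bsub>R\<^esub> p \<otimes>\<^bsub>R\<^esub> q = \<one>\<^bsub>R\<^esub>"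
      then have "p \<otimes>\<^bsub>R\<^esub> q = q" using p q by (metis R.inv_closed R.inv_inv R.inv_solve_left R.m_assoc R.m_closed R.one_closed R.r_one)
      then show "p = \<one>\<^bsub>R\<^esub>" using p q by (metis R.l_one R.one_closed R.right_cancel)
    qed (use q in simp)
    then show "?l (inv\<^bsub>H \<times>\<times> R\<^esub> y \<otimes>\<^bsub>H \<times>\<times> R\<^esub> x \<otimes>\<^bsub>H \<times>\<times> R\<^esub> y) = ?l x"
      using H.length_conj[OF g h] g h p q by (simp add: x y H.is_group R.is_group)
  qed
qed

section \<open>Copies of finite groups on the natural numbers\<close>

text \<open>
  Finite groups of unrelated types, such as iterated products with quotients, have to be brought to
  one type before they can form a single family.
\<close>

lemma finite_group_nat_copy:
  assumes "group G" and fin: "finite (carrier G)"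
  obtains R :: "nat monoid" and k
  where "group R" "finite (carrier R)" "k \<in> iso R G"
proof -
  interpret group G by fact
  obtain e :: "'a \<Rightarrow> nat" where e: "inj_on e (carrier G)"
    using finite_imp_inj_to_nat_seg[OF fin] by blast
  define d where "d = inv_into (carrier G) e"
  have de: "d (e x) = x" if "x \<in> carrier G" for x using e that by (simp add: d_def)
  define R where "R = \<lparr>carrier = e ` carrier G, monoid.mult = (\<lambda>a b. e (d a \<otimes>\<^bsub>G\<^esub> d b)), one = e \<one>\<^bsub>G\<^esub>\<rparr>"
  have "group R"
  proof (rule groupI)
    fix x assume "x \<in> carrier R"
    then obtain g where "g \<in> carrier G" "x = e g" by (auto simp: R_def)
    then show "\<exists>y\<in>carrier R. y \<otimes>\<^bsub>R\<^esub> x = \<one>\<^bsub>R\<^esub>"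
      by (intro bexI[of _ "e (inv\<^bsub>G\<^esub> g)"]) (auto simp: R_def de)
  qed (auto simp: R_def de m_assoc)
  moreover have "d \<in> iso R G"
    unfolding iso_def hom_def bij_betw_def
    by (auto simp: R_def de inj_on_def image_iff)
  ultimately show ?thesis using that fin by (auto simp: R_def)
qed

section \<open>Finite quotients\<close>

text \<open>
  Multiplying finitely many finite quotients, one for each element, separates all the elements at
  once.  The induction moves each product back to the natural numbers, since otherwise the type of
  the quotient would grow with the set.
\<close>

lemma residually_finite_separates_finite_set:
  fixes Q :: "('a, 'b) monoid_scheme"
  assumes Q: "residually_finite Q" and "finite E" "E \<subseteq> carrier Q" "\<one>\<^bsub>Q\<^esub> \<notin> E"
  shows "\<exists>(R :: nat monoid) \<rho>. group R \<and> finite (carrier R) \<and> \<rho> \<in> hom Q R \<and> (\<forall>q\<in>E. \<rho> q \<noteq> \<one>\<^bsub>R\<^esub>)"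
  using assms(2-4)
proof (induction E rule: finite_induct)
  case empty
  have "(\<lambda>_. 0) \<in> hom Q (singleton_group (0 :: nat))"
    by (auto simp: hom_def singleton_group_def)
  then show ?case
    by (intro exI[of _ "singleton_group 0"] exI[of _ "\<lambda>_. 0"]) (simp add: carrier_singleton_group)
next
  case (insert g E)
  obtain R :: "nat monoid" and \<rho> where R: "group R" "finite (carrier R)" "\<rho> \<in> hom Q R"
    and sep: "\<And>q. q \<in> E \<Longrightarrow> \<rho> q \<noteq> \<one>\<^bsub>R\<^esub>"
    using insert by auto
  have g: "g \<in> carrier Q" "g \<noteq> \<one>\<^bsub>Q\<^esub>" using insert.prems by auto
  then obtain K where K: "K \<lhd> Q" "finite (carrier (Q Mod K))" "g \<notin> K"
    using Q unfolding residually_finite_def by blast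
  interpret K: normal K Q by (rule K(1))
  let ?D = "R \<times>\<times> (Q Mod K)" and ?\<sigma> = "\<lambda>q. (\<rho> q, K #>\<^bsub>Q\<^esub> q)"
  have grp: "group ?D" by (rule DirProd_group[OF R(1) K.factorgroup_is_group])
  have fin: "finite (carrier ?D)" using R(2) K(2) by simp
  obtain S :: "nat monoid" and k where S: "group S" "finite (carrier S)" "k \<in> iso S ?D"
    using finite_group_nat_copy[OF grp fin] by blast
  define j where "j = inv_into (carrier S) k"
  have j: "j \<in> iso ?D S" unfolding j_def using group.iso_set_sym[OF S(1,3)] .
  have jc: "j \<in> mon ?D S" using j by (simp add: iso_def mon_def bij_betw_def)
  have s: "?\<sigma> \<in> hom Q ?D"
    using R(3) K.r_coset_hom_Mod by (auto simp: hom_def Pi_iff)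
  have "j \<circ> ?\<sigma> \<in> hom Q S"
    by (rule hom_compose[OF s iso_imp_homomorphism[OF j]])
  moreover have "(j \<circ> ?\<sigma>) q \<noteq> \<one>\<^bsub>S\<^esub>" if q: "q \<in> insert g E" for q
  proof
    assume 1: "(j \<circ> ?\<sigma>) q = \<one>\<^bsub>S\<^esub>"
    interpret j: group_hom ?D S j
      using grp S(1) jc by (simp add: group_hom_def group_hom_axioms_def mon_def)
    have "q \<in> carrier Q" using q insert.prems by auto
    then have "?\<sigma> q \<in> carrier ?D" using s by (meson hom_carrier image_subset_iff)
    then have "?\<sigma> q = \<one>\<^bsub>?D\<^esub>" using 1 jc j.inj_on_one_iff by (auto simp: mon_def)
    then have "\<rho> q = \<one>\<^bsub>R\<^esub>" "K #>\<^bsub>Q\<^esub> q = K" by (auto simp: FactGroup_def)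
    then show False using q sep K(3) g(1) K.coset_join1[of K g] K.subgroup_axioms by auto
  qed
  ultimately show ?case using S by blast
qed

section \<open>Finite models\<close>

text \<open>
  A model of \<open>P\<close> on \<open>E\<close> up to \<open>\<epsilon>\<close>: an almost homomorphism \<open>f\<close> to a finite group with lengths at most
  \<open>C\<close>, which gives \<open>p\<close> almost the length \<open>r p\<close>.  When \<open>E\<close> grows and \<open>\<epsilon>\<close> shrinks, the same \<open>r\<close>
  serves all the models; an element with \<open>r p \<noteq> 0\<close> then stays away from the identity in the limit.
\<close>

definition finite_model ::
    "('p, 'q) monoid_scheme \<Rightarrow> ('p \<Rightarrow> real) \<Rightarrow> 'p set \<Rightarrow> real \<Rightarrow> real \<Rightarrow>
     ('g, 'h) monoid_scheme \<Rightarrow> ('g \<Rightarrow> real) \<Rightarrow> ('p \<Rightarrow> 'g) \<Rightarrow> bool" where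
  "finite_model P r E \<epsilon> C H l f \<longleftrightarrow>
     finite (carrier H) \<and> invariant_length_function H l \<and> (\<forall>h\<in>carrier H. l h \<le> C) \<and>
     f \<in> carrier P \<rightarrow> carrier H \<and>
     (\<forall>p\<in>E. \<forall>q\<in>E. l (f p \<otimes>\<^bsub>H\<^esub> f q \<otimes>\<^bsub>H\<^esub> inv\<^bsub>H\<^esub> (f (p \<otimes>\<^bsub>P\<^esub> q))) < \<epsilon>) \<and>
     (\<forall>p\<in>E. \<bar>l (f p) - r p\<bar> < \<epsilon>)"

lemma finite_model_nat_copy:
  assumes M: "finite_model P r E \<epsilon> C H l f" and P: "group P" and E: "E \<subseteq> carrier P"
  shows "\<exists>(K :: nat monoid) l' f'. finite_model P r E \<epsilon> C K l' f'"
proof -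
  have l: "invariant_length_function H l" and fin: "finite (carrier H)"
    and f: "\<And>p. p \<in> carrier P \<Longrightarrow> f p \<in> carrier H"
    using M by (auto simp: finite_model_def)
  interpret P: group P by fact
  interpret H: invariant_length_function H l by fact
  obtain K :: "nat monoid" and k where K: "group K" "finite (carrier K)" "k \<in> iso K H"
    using finite_group_nat_copy[OF H.is_group fin] by blast
  interpret k: group_hom K H k
    using K H.is_group by (simp add: group_hom_def group_hom_axioms_def iso_def)
  define j where "j = inv_into (carrier K) k"
  have bij: "k ` carrier K = carrier H" using K(3) by (simp add: iso_def bij_betw_def)
  have j: "j h \<in> carrier K" and kj: "k (j h) = h" if "h \<in> carrier H" for h
    using that by (simp_all add: j_def bij inv_into_into f_inv_into_f)
  have "finite_model P r E \<epsilon> C K (\<lambda>x. l (k x)) (\<lambda>p. j (f p))"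
    unfolding finite_model_def
  proof (intro conjI ballI)
    show "invariant_length_function K (\<lambda>x. l (k x))"
      using K by (intro invariant_length_function_mon[OF l]) (auto simp: iso_iff_mon_epi)
    show "(\<lambda>p. j (f p)) \<in> carrier P \<rightarrow> carrier K" using f j by blast
    fix p assume p: "p \<in> E"
    show "\<bar>l (k (j (f p))) - r p\<bar> < \<epsilon>" using M p E f kj by (auto simp: finite_model_def)
    fix q assume q: "q \<in> E"
    have pq: "p \<in> carrier P" "q \<in> carrier P" using p q E by auto
    have "k (j (f p) \<otimes>\<^bsub>K\<^esub> j (f q) \<otimes>\<^bsub>K\<^esub> inv\<^bsub>K\<^esub> j (f (p \<otimes>\<^bsub>P\<^esub> q)))
          = f p \<otimes>\<^bsub>H\<^esub> f q \<otimes>\<^bsub>H\<^esub> inv\<^bsub>H\<^esub> f (p \<otimes>\<^bsub>P\<^esub> q)"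
      using pq by (simp add: f j kj)
    then show "l (k (j (f p) \<otimes>\<^bsub>K\<^esub> j (f q) \<otimes>\<^bsub>K\<^esub> inv\<^bsub>K\<^esub> j (f (p \<otimes>\<^bsub>P\<^esub> q)))) < \<epsilon>"
      using M p q by (simp add: finite_model_def)
  qed (use K M in \<open>auto simp: finite_model_def\<close>)
  then show ?thesis by blast
qed

text \<open>
  Pairing with an exact homomorphism \<open>\<rho>\<close> does not affect the multiplicative defect: its second
  component is trivial, so its length is the length of the defect in \<open>H\<close>.
\<close>

lemma finite_model_DirProd:
  assumes M: "finite_model P r E \<epsilon> (1 / 2) H l f" and P: "group P" and E: "E \<subseteq> carrier P"
    and R: "group R" "finite (carrier R)" and \<rho>: "\<rho> \<in> hom P R" and \<epsilon>: "0 < \<epsilon>"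
    and ker: "\<And>p. p \<in> E \<Longrightarrow> \<rho> p = \<one>\<^bsub>R\<^esub> \<longleftrightarrow> p \<in> P1"
  shows "finite_model P (\<lambda>p. if p \<in> P1 then r p else 1) E \<epsilon> 1 (H \<times>\<times> R)
           (\<lambda>(h, q). if q = \<one>\<^bsub>R\<^esub> then l h else 1) (\<lambda>p. (f p, \<rho> p))"
proof -
  have l: "invariant_length_function H l" and fin: "finite (carrier H)"
    and f: "\<And>p. p \<in> carrier P \<Longrightarrow> f p \<in> carrier H"
    and half: "\<And>h. h \<in> carrier H \<Longrightarrow> l h \<le> 1 / 2"
    using M by (auto simp: finite_model_def)
  interpret P: group P by fact
  interpret R: group R by fact
  interpret H: invariant_length_function H l by fact
  interpret \<rho>: group_hom P R \<rho> using \<rho> by unfold_locales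
  let ?L = "\<lambda>(h, q). if q = \<one>\<^bsub>R\<^esub> then l h else (1 :: real)"
  have "?L ((f p, \<rho> p) \<otimes>\<^bsub>H \<times>\<times> R\<^esub> (f q, \<rho> q) \<otimes>\<^bsub>H \<times>\<times> R\<^esub> inv\<^bsub>H \<times>\<times> R\<^esub> (f (p \<otimes>\<^bsub>P\<^esub> q), \<rho> (p \<otimes>\<^bsub>P\<^esub> q))) < \<epsilon>"
    if "p \<in> E" "q \<in> E" for p q
  proof -
    have pq: "p \<in> carrier P" "q \<in> carrier P" using that E by auto
    show ?thesis
      using pq M that by (simp add: f H.is_group R.is_group finite_model_def)
  qed
  moreover have "\<bar>?L (f p, \<rho> p) - (if p \<in> P1 then r p else 1)\<bar> < \<epsilon>" if "p \<in> E" for p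
    using M that ker[OF that] \<epsilon> by (simp add: finite_model_def)
  moreover have "?L x \<le> 1" if "x \<in> carrier (H \<times>\<times> R)" for x
    using that half by force
  ultimately show ?thesis
    using invariant_length_function_DirProd[OF l R(1) half] fin R f
    unfolding finite_model_def by auto
qed

text \<open>
  Choose a representing sequence for the image of each element.  After truncation, the lengths of
  these sequences converge, and their limits are the values of \<open>r\<close>.  All the conditions on a finite
  set hold for almost all indices along the ultrafilter, so some single index satisfies them
  simultaneously.
\<close>

lemma weakly_sofic_finite_models:
  fixes P :: "('p, 'q) monoid_scheme"
  assumes W: "weakly_sofic TYPE('i) TYPE('g) P" and c: "0 < c"
  obtains r where "\<forall>p\<in>carrier P. p \<noteq> \<one>\<^bsub>P\<^esub> \<longrightarrow> r p \<noteq> 0"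
    and "\<forall>p\<in>carrier P. r p \<le> c"
    and "\<forall>E \<epsilon>. finite E \<longrightarrow> E \<subseteq> carrier P \<longrightarrow> 0 < \<epsilon> \<longrightarrow>
           (\<exists>(H :: 'g monoid) l f. finite_model P r E \<epsilon> c H l f)"
proof -
  from W obtain I :: "'i set" and H :: "'i \<Rightarrow> 'g monoid" and l \<Phi> \<phi>
    where P: "group P" and U: "ultrafilter_on I \<Phi>"
      and fin: "\<And>i. i \<in> I \<Longrightarrow> finite (carrier (H i))"
      and L: "\<And>i. i \<in> I \<Longrightarrow> invariant_length_function (H i) (l i)"
      and \<phi>: "\<phi> \<in> mon P (metric_ultraproduct I H l \<Phi>)"
    unfolding weakly_sofic_def by blast
  interpret P: group P by fact
  let ?G = "product_group I H" and ?N = "null_subgroup I H l \<Phi>"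
  have grp: "group (H i)" if "i \<in> I" for i
    using L[OF that] by (simp add: invariant_length_function_def length_function_def)
  interpret G: group ?G using grp by simp
  interpret N: normal ?N ?G by (rule normal_null_subgroup[OF U L])
  note ev = ultrafilter_on_eventually_mem[OF U]
  have nb: "\<Phi> \<noteq> bot" using U by (simp add: ultrafilter_on_def)
  interpret \<phi>: group_hom P "?G Mod ?N" \<phi>
    using \<phi> P N.factorgroup_is_group
    by (simp add: group_hom_def group_hom_axioms_def mon_def metric_ultraproduct_def)
  have "\<exists>x. x \<in> carrier ?G \<and> \<phi> p = ?N #>\<^bsub>?G\<^esub> x" if "p \<in> carrier P" for p
    using \<phi>.hom_closed[OF that] by (auto simp: FactGroup_def RCOSETS_def)
  then obtain x where x: "\<And>p. p \<in> carrier P \<Longrightarrow> x p \<in> carrier ?G"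
    and x\<phi>: "\<And>p. p \<in> carrier P \<Longrightarrow> \<phi> p = ?N #>\<^bsub>?G\<^esub> x p" by metis
  have xi: "x p i \<in> carrier (H i)" if "p \<in> carrier P" "i \<in> I" for p i
    using x[OF that(1)] that(2) by auto
  define m where "m = (\<lambda>i h. min (l i h) c)"
  have m: "invariant_length_function (H i) (m i)" if "i \<in> I" for i
    unfolding m_def by (rule invariant_length_function_min[OF L[OF that] c])
  have mle: "m i h \<le> c" for i h by (simp add: m_def)
  have m0: "0 \<le> m i h" if "i \<in> I" "h \<in> carrier (H i)" for i h
  proof -
    interpret invariant_length_function "H i" "m i" by (rule m[OF that(1)])
    show ?thesis using length_nonneg that(2) .
  qed
  have "\<exists>s. ((\<lambda>i. m i (x p i)) \<longlongrightarrow> s) \<Phi>" if p: "p \<in> carrier P" for p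
  proof -
    have "0 \<le> m i (x p i) \<and> m i (x p i) \<le> c" if "i \<in> I" for i
      using m0[OF that xi[OF p that]] mle by blast
    then obtain s where "((\<lambda>i. m i (x p i)) \<longlongrightarrow> s) \<Phi>"
      by (rule ultrafilter_on_bounded_tendsto[OF U])
    then show ?thesis ..
  qed
  then obtain r where r: "\<And>p. p \<in> carrier P \<Longrightarrow> ((\<lambda>i. m i (x p i)) \<longlongrightarrow> r p) \<Phi>" by metis
  have defect: "((\<lambda>i. l i (x p i \<otimes>\<^bsub>H i\<^esub> x q i \<otimes>\<^bsub>H i\<^esub> inv\<^bsub>H i\<^esub> (x (p \<otimes>\<^bsub>P\<^esub> q) i))) \<longlongrightarrow> 0) \<Phi>"
    if p: "p \<in> carrier P" and q: "q \<in> carrier P" for p q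
  proof -
    have pq: "p \<otimes>\<^bsub>P\<^esub> q \<in> carrier P" using p q by simp
    have "?N #>\<^bsub>?G\<^esub> x (p \<otimes>\<^bsub>P\<^esub> q) = (?N #>\<^bsub>?G\<^esub> x p) <#>\<^bsub>?G\<^esub> (?N #>\<^bsub>?G\<^esub> x q)"
      using \<phi>.hom_mult[OF p q] x\<phi> p q by (simp add: FactGroup_def)
    also have "\<dots> = ?N #>\<^bsub>?G\<^esub> (x p \<otimes>\<^bsub>?G\<^esub> x q)" using x p q by (intro N.rcos_sum) auto
    finally have "x p \<otimes>\<^bsub>?G\<^esub> x q \<in> ?N #>\<^bsub>?G\<^esub> x (p \<otimes>\<^bsub>P\<^esub> q)"
      using G.rcos_self[OF G.m_closed[OF x[OF p] x[OF q]] N.subgroup_axioms] by simp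
    then have "x p \<otimes>\<^bsub>?G\<^esub> x q \<otimes>\<^bsub>?G\<^esub> inv\<^bsub>?G\<^esub> x (p \<otimes>\<^bsub>P\<^esub> q) \<in> ?N"
      by (rule N.rcos_module_imp[OF G.is_group x[OF pq]])
    then have t: "((\<lambda>i. l i ((x p \<otimes>\<^bsub>?G\<^esub> x q \<otimes>\<^bsub>?G\<^esub> inv\<^bsub>?G\<^esub> x (p \<otimes>\<^bsub>P\<^esub> q)) i)) \<longlongrightarrow> 0) \<Phi>"
      by (simp add: null_subgroup_def)
    have inv: "inv\<^bsub>?G\<^esub> x (p \<otimes>\<^bsub>P\<^esub> q) = (\<lambda>i\<in>I. inv\<^bsub>H i\<^esub> (x (p \<otimes>\<^bsub>P\<^esub> q) i))"
      using x[OF pq] grp by (intro inv_product_group) auto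
    show ?thesis
      by (rule Lim_transform_eventually[OF t], rule eventually_mono[OF ev]) (simp add: inv)
  qed
  show ?thesis
  proof (rule that; intro ballI allI impI)
    fix p assume p: "p \<in> carrier P" and "p \<noteq> \<one>\<^bsub>P\<^esub>"
    show "r p \<noteq> 0"
    proof
      assume "r p = 0"
      then have t: "((\<lambda>i. m i (x p i)) \<longlongrightarrow> 0) \<Phi>" using r[OF p] by simp
      \<comment> \<open>near \<open>0\<close> the truncated length is the original one, which therefore tends to \<open>0\<close> as well\<close>
      have "eventually (\<lambda>i. m i (x p i) < c) \<Phi>" using order_tendstoD(2)[OF t c] .
      then have "eventually (\<lambda>i. m i (x p i) = l i (x p i)) \<Phi>"
        by (rule eventually_mono) (auto simp: m_def min_def split: if_splits)
      then have "((\<lambda>i. l i (x p i)) \<longlongrightarrow> 0) \<Phi>" by (rule Lim_transform_eventually[OF t])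
      then have "x p \<in> ?N" using x[OF p] by (simp add: null_subgroup_def)
      then have "\<phi> p = \<one>\<^bsub>?G Mod ?N\<^esub>"
        using x\<phi>[OF p] N.rcos_const[OF G.is_group] by (simp add: FactGroup_def)
      then show False using \<phi> p \<open>p \<noteq> \<one>\<^bsub>P\<^esub>\<close> \<phi>.inj_on_one_iff by (auto simp: mon_def)
    qed
  next
    fix p assume p: "p \<in> carrier P"
    show "r p \<le> c" by (rule tendsto_upperbound[OF r[OF p] _ nb]) (simp add: mle)
  next
    fix E and \<epsilon> :: real assume E: "finite E" "E \<subseteq> carrier P" and \<epsilon>: "0 < \<epsilon>"
    have "eventually (\<lambda>i. \<forall>p\<in>E. \<bar>m i (x p i) - r p\<bar> < \<epsilon>) \<Phi>"
    proof (intro eventually_ball_finite ballI E)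
      fix p assume "p \<in> E"
      then show "eventually (\<lambda>i. \<bar>m i (x p i) - r p\<bar> < \<epsilon>) \<Phi>"
        using tendstoD[OF r \<epsilon>, of p] E by (auto simp: dist_real_def)
    qed
    moreover have "eventually (\<lambda>i. \<forall>p\<in>E. \<forall>q\<in>E.
        l i (x p i \<otimes>\<^bsub>H i\<^esub> x q i \<otimes>\<^bsub>H i\<^esub> inv\<^bsub>H i\<^esub> (x (p \<otimes>\<^bsub>P\<^esub> q) i)) < \<epsilon>) \<Phi>"
      using E order_tendstoD(2)[OF defect \<epsilon>] by (intro eventually_ball_finite ballI) auto
    ultimately have "eventually (\<lambda>i. i \<in> I \<and> (\<forall>p\<in>E. \<bar>m i (x p i) - r p\<bar> < \<epsilon>) \<and> (\<forall>p\<in>E. \<forall>q\<in>E.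
        l i (x p i \<otimes>\<^bsub>H i\<^esub> x q i \<otimes>\<^bsub>H i\<^esub> inv\<^bsub>H i\<^esub> (x (p \<otimes>\<^bsub>P\<^esub> q) i)) < \<epsilon>)) \<Phi>"
      using ev by (simp add: eventually_conj_iff)
    then obtain i where i: "i \<in> I" and a: "\<forall>p\<in>E. \<bar>m i (x p i) - r p\<bar> < \<epsilon>"
      and b: "\<forall>p\<in>E. \<forall>q\<in>E. l i (x p i \<otimes>\<^bsub>H i\<^esub> x q i \<otimes>\<^bsub>H i\<^esub> inv\<^bsub>H i\<^esub> (x (p \<otimes>\<^bsub>P\<^esub> q) i)) < \<epsilon>"
      using eventually_happens'[OF nb] by blast
    have "finite_model P r E \<epsilon> c (H i) (m i) (\<lambda>p. x p i)"
      unfolding finite_model_def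
    proof (intro conjI ballI)
      show "(\<lambda>p. x p i) \<in> carrier P \<rightarrow> carrier (H i)" using xi i by blast
      fix p q assume "p \<in> E" "q \<in> E"
      then show "m i (x p i \<otimes>\<^bsub>H i\<^esub> x q i \<otimes>\<^bsub>H i\<^esub> inv\<^bsub>H i\<^esub> (x (p \<otimes>\<^bsub>P\<^esub> q) i)) < \<epsilon>"
        using b by (simp add: m_def min_less_iff_disj)
    qed (use i a fin m mle in blast)+
    then show "\<exists>(H :: 'g monoid) l f. finite_model P r E \<epsilon> c H l f" by blast
  qed
qed

section \<open>From finite models to an ultraproduct over the natural numbers\<close>

text \<open>
  Take the \<open>n\<close>-th model on the first \<open>n + 1\<close> elements with error \<open>1 / (n + 1)\<close>.  Defects then tend to
  \<open>0\<close> and lengths to \<open>r\<close> along the sequence itself, hence along every nonprincipal ultrafilter.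
\<close>

lemma ultraproduct_of_finite_models:
  fixes P :: "('p, 'q) monoid_scheme"
  assumes P: "group P" and cnt: "countable (carrier P)"
    and r: "\<And>p. p \<in> carrier P \<Longrightarrow> p \<noteq> \<one>\<^bsub>P\<^esub> \<Longrightarrow> r p \<noteq> 0"
    and models: "\<And>E \<epsilon>. finite E \<Longrightarrow> E \<subseteq> carrier P \<Longrightarrow> 0 < \<epsilon> \<Longrightarrow>
           \<exists>(H :: 'g monoid) l f. finite_model P r E \<epsilon> c H l f"
  obtains H :: "nat \<Rightarrow> 'g monoid" and l \<Phi> \<phi>
  where "ultrafilter_on UNIV \<Phi>"
    and "\<forall>n. finite (carrier (H n)) \<and> invariant_length_function (H n) (l n) \<and>
             (\<forall>h\<in>carrier (H n). l n h \<le> c)"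
    and "\<phi> \<in> mon P (metric_ultraproduct UNIV H l \<Phi>)"
    and "\<forall>p\<in>carrier P. ultraproduct_norm l \<Phi> (\<phi> p) = r p"
proof -
  interpret P: group P by fact
  define E where "E = (\<lambda>n. from_nat_into (carrier P) ` {..n :: nat})"
  have "\<exists>(H :: 'g monoid) l f. finite_model P r (E n) (inverse (real (Suc n))) c H l f" for n
    by (rule models) (auto simp: E_def intro: from_nat_into)
  then obtain H :: "nat \<Rightarrow> 'g monoid" and l f
    where M: "\<And>n. finite_model P r (E n) (inverse (real (Suc n))) c (H n) (l n) (f n)" by metis
  have L: "invariant_length_function (H n) (l n)" for n using M[of n] by (simp add: finite_model_def)
  have f: "f n p \<in> carrier (H n)" if "p \<in> carrier P" for n p
    using M[of n] that by (auto simp: finite_model_def)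
  have grp: "group (H n)" for n
    using L[of n] by (simp add: invariant_length_function_def length_function_def)
  have evE: "eventually (\<lambda>n. p \<in> E n) sequentially" if p: "p \<in> carrier P" for p
  proof -
    obtain k where "from_nat_into (carrier P) k = p" using from_nat_into_surj[OF cnt p] by blast
    then show ?thesis unfolding E_def by (intro eventually_sequentiallyI[of k]) auto
  qed
  have norm: "(\<lambda>n. l n (f n p)) \<longlonglongrightarrow> r p" if p: "p \<in> carrier P" for p
  proof (rule LIM_zero_cancel, rule tendsto_0_le[OF LIMSEQ_inverse_real_of_nat, where K = 1])
    show "eventually (\<lambda>n. norm (l n (f n p) - r p) \<le> norm (inverse (real (Suc n))) * 1) sequentially"
    proof (rule eventually_mono[OF evE[OF p]])
      fix n assume "p \<in> E n"
      then show "norm (l n (f n p) - r p) \<le> norm (inverse (real (Suc n))) * 1"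
        using M[of n] by (auto simp: finite_model_def less_imp_le)
    qed
  qed
  have defect: "(\<lambda>n. l n (f n p \<otimes>\<^bsub>H n\<^esub> f n q \<otimes>\<^bsub>H n\<^esub> inv\<^bsub>H n\<^esub> f n (p \<otimes>\<^bsub>P\<^esub> q))) \<longlonglongrightarrow> 0"
    if p: "p \<in> carrier P" and q: "q \<in> carrier P" for p q
  proof (rule tendsto_0_le[OF LIMSEQ_inverse_real_of_nat, where K = 1])
    show "eventually (\<lambda>n. norm (l n (f n p \<otimes>\<^bsub>H n\<^esub> f n q \<otimes>\<^bsub>H n\<^esub> inv\<^bsub>H n\<^esub> f n (p \<otimes>\<^bsub>P\<^esub> q)))
            \<le> norm (inverse (real (Suc n))) * 1) sequentially"
      using evE[OF p] evE[OF q]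
    proof eventually_elim
      case (elim n)
      interpret invariant_length_function "H n" "l n" by (rule L)
      let ?d = "f n p \<otimes>\<^bsub>H n\<^esub> f n q \<otimes>\<^bsub>H n\<^esub> inv\<^bsub>H n\<^esub> f n (p \<otimes>\<^bsub>P\<^esub> q)"
      have "0 \<le> l n ?d" using p q f by (intro length_nonneg) auto
      moreover have "l n ?d < inverse (real (Suc n))"
        using M[of n] elim unfolding finite_model_def by blast
      ultimately show ?case by simp
    qed
  qed
  obtain \<Phi> where U: "ultrafilter_on UNIV \<Phi>" and \<Phi>: "\<Phi> \<le> sequentially"
    using ultrafilter_below[of sequentially UNIV] by auto
  let ?G = "product_group UNIV H" and ?N = "null_subgroup UNIV H l \<Phi>"
  interpret G: group ?G using grp by simp
  interpret N: normal ?N ?G by (rule normal_null_subgroup[OF U L])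
  define x where "x = (\<lambda>p n. f n p)"
  define \<phi> where "\<phi> = (\<lambda>p. ?N #>\<^bsub>?G\<^esub> x p)"
  have x: "x p \<in> carrier ?G" if "p \<in> carrier P" for p using f that by (auto simp: x_def)
  have xn: "((\<lambda>n. l n (x p n)) \<longlongrightarrow> r p) \<Phi>" if "p \<in> carrier P" for p
    unfolding x_def by (rule tendsto_mono[OF \<Phi> norm[OF that]])
  have hom: "\<phi> \<in> hom P (?G Mod ?N)"
  proof (rule homI)
    fix p assume p: "p \<in> carrier P"
    then show "\<phi> p \<in> carrier (?G Mod ?N)" using x unfolding \<phi>_def FactGroup_def RCOSETS_def by auto
    fix q assume q: "q \<in> carrier P"
    have pq: "p \<otimes>\<^bsub>P\<^esub> q \<in> carrier P" using p q by simp
    have inv: "inv\<^bsub>?G\<^esub> x (p \<otimes>\<^bsub>P\<^esub> q) = (\<lambda>n. inv\<^bsub>H n\<^esub> (x (p \<otimes>\<^bsub>P\<^esub> q) n))"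
      using inv_product_group[of "x (p \<otimes>\<^bsub>P\<^esub> q)" UNIV H] x[OF pq] grp by (simp add: restrict_UNIV)
    have "x p \<otimes>\<^bsub>?G\<^esub> x q \<otimes>\<^bsub>?G\<^esub> inv\<^bsub>?G\<^esub> x (p \<otimes>\<^bsub>P\<^esub> q) \<in> ?N"
      unfolding null_subgroup_def mem_Collect_eq
    proof
      show "x p \<otimes>\<^bsub>?G\<^esub> x q \<otimes>\<^bsub>?G\<^esub> inv\<^bsub>?G\<^esub> x (p \<otimes>\<^bsub>P\<^esub> q) \<in> carrier ?G"
        by (intro G.m_closed G.inv_closed x p q pq)
      show "((\<lambda>n. l n ((x p \<otimes>\<^bsub>?G\<^esub> x q \<otimes>\<^bsub>?G\<^esub> inv\<^bsub>?G\<^esub> x (p \<otimes>\<^bsub>P\<^esub> q)) n)) \<longlongrightarrow> 0) \<Phi>"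
        using tendsto_mono[OF \<Phi> defect[OF p q]] inv by (simp add: x_def)
    qed
    then have "x p \<otimes>\<^bsub>?G\<^esub> x q \<in> ?N #>\<^bsub>?G\<^esub> x (p \<otimes>\<^bsub>P\<^esub> q)"
      by (intro N.rcos_module_rev G.is_group x G.m_closed p q pq)
    then have "?N #>\<^bsub>?G\<^esub> x (p \<otimes>\<^bsub>P\<^esub> q) = ?N #>\<^bsub>?G\<^esub> (x p \<otimes>\<^bsub>?G\<^esub> x q)"
      by (rule G.repr_independence[OF _ x[OF pq] N.subgroup_axioms])
    then show "\<phi> (p \<otimes>\<^bsub>P\<^esub> q) = \<phi> p \<otimes>\<^bsub>?G Mod ?N\<^esub> \<phi> q"
      unfolding \<phi>_def FactGroup_def using N.rcos_sum[OF x[OF p] x[OF q]] by simp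
  qed
  interpret \<phi>: group_hom P "?G Mod ?N" \<phi>
    using hom P N.factorgroup_is_group by (simp add: group_hom_def group_hom_axioms_def)
  have "inj_on \<phi> (carrier P)"
  proof (subst \<phi>.inj_on_one_iff, intro allI impI)
    fix p assume p: "p \<in> carrier P" and "\<phi> p = \<one>\<^bsub>?G Mod ?N\<^esub>"
    then have "?N #>\<^bsub>?G\<^esub> x p = ?N" by (simp add: \<phi>_def FactGroup_def)
    then have "x p \<in> ?N" by (rule G.coset_join1[OF _ x[OF p] N.subgroup_axioms])
    then have "((\<lambda>n. l n (x p n)) \<longlongrightarrow> 0) \<Phi>" by (simp add: null_subgroup_def)
    then have "r p = 0" using tendsto_unique[OF _ xn[OF p]] U by (simp add: ultrafilter_on_def)
    then show "p = \<one>\<^bsub>P\<^esub>" using r p by blast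
  qed
  then have "\<phi> \<in> mon P (metric_ultraproduct UNIV H l \<Phi>)"
    using hom by (simp add: mon_def metric_ultraproduct_def)
  moreover have "ultraproduct_norm l \<Phi> (\<phi> p) = r p" if "p \<in> carrier P" for p
    unfolding \<phi>_def by (rule ultraproduct_norm_unique[OF U L x[OF that] xn[OF that]])
  moreover have "\<forall>n. finite (carrier (H n)) \<and> invariant_length_function (H n) (l n) \<and>
      (\<forall>h\<in>carrier (H n). l n h \<le> c)"
    using M unfolding finite_model_def by blast
  ultimately show ?thesis using that[OF U] by blast
qed

section \<open>Embeddings in which a normal subgroup is the ball of radius one half\<close>

text \<open>
  The kernels of homomorphisms from \<open>P\<close> to residually finite groups are the normal subgroups with
  residually finite quotient.  The norm of \<open>p\<close> is \<open>r p \<le> 1 / 2\<close> on the kernel and \<open>1\<close> off it.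
\<close>

theorem weakly_sofic_embedding_with_half_ball:
  fixes P :: "('p, 'q) monoid_scheme" and Q :: "('r, 's) monoid_scheme"
  assumes W: "weakly_sofic TYPE('i) TYPE('g) P" and cnt: "countable (carrier P)"
    and Q: "residually_finite Q" and \<pi>: "\<pi> \<in> hom P Q"
  obtains H :: "nat \<Rightarrow> nat monoid" and l \<Phi> \<phi>
  where "ultrafilter_on UNIV \<Phi>"
    and "\<forall>n. finite (carrier (H n)) \<and> invariant_length_function (H n) (l n) \<and>
             (\<forall>h\<in>carrier (H n). l n h \<le> 1)"
    and "\<phi> \<in> mon P (metric_ultraproduct UNIV H l \<Phi>)"
    and "kernel P Q \<pi> = {p \<in> carrier P. ultraproduct_norm l \<Phi> (\<phi> p) \<le> 1 / 2}"
proof -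
  have P: "group P" using W by (simp add: weakly_sofic_def)
  have half: "(0 :: real) < 1 / 2" by simp
  obtain r where r0: "\<forall>p\<in>carrier P. p \<noteq> \<one>\<^bsub>P\<^esub> \<longrightarrow> r p \<noteq> 0"
    and rle: "\<forall>p\<in>carrier P. r p \<le> 1 / 2"
    and models: "\<forall>E \<epsilon>. finite E \<longrightarrow> E \<subseteq> carrier P \<longrightarrow> 0 < \<epsilon> \<longrightarrow>
           (\<exists>(H :: 'g monoid) l f. finite_model P r E \<epsilon> (1 / 2) H l f)"
    by (rule weakly_sofic_finite_models[OF W half])
  define s where "s = (\<lambda>p. if p \<in> kernel P Q \<pi> then r p else 1)"
  have s_models: "\<exists>(K :: nat monoid) l f. finite_model P s E \<epsilon> 1 K l f"
    if E: "finite E" "E \<subseteq> carrier P" and \<epsilon>: "0 < \<epsilon>" for E \<epsilon>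
  proof -
    obtain H :: "'g monoid" and l f where M: "finite_model P r E \<epsilon> (1 / 2) H l f"
      using models E \<epsilon> by blast
    \<comment> \<open>on \<open>E\<close>, the finite quotient has to detect exactly the kernel of \<open>\<pi>\<close>\<close>
    have "\<pi> ` E - {\<one>\<^bsub>Q\<^esub>} \<subseteq> carrier Q" using \<pi> E by (auto simp: hom_def)
    then obtain R :: "nat monoid" and \<rho> where R: "group R" "finite (carrier R)"
      and \<rho>: "\<rho> \<in> hom Q R" and sep: "\<And>q. q \<in> \<pi> ` E - {\<one>\<^bsub>Q\<^esub>} \<Longrightarrow> \<rho> q \<noteq> \<one>\<^bsub>R\<^esub>"
      using residually_finite_separates_finite_set[OF Q, of "\<pi> ` E - {\<one>\<^bsub>Q\<^esub>}"] E(1) by auto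
    have "\<rho> \<one>\<^bsub>Q\<^esub> = \<one>\<^bsub>R\<^esub>" using hom_one[OF \<rho>] Q R(1) by (simp add: residually_finite_def)
    then have "(\<rho> \<circ> \<pi>) p = \<one>\<^bsub>R\<^esub> \<longleftrightarrow> p \<in> kernel P Q \<pi>" if "p \<in> E" for p
      using sep[of "\<pi> p"] that E(2) by (auto simp: kernel_def)
    from finite_model_DirProd[OF M P E(2) R hom_compose[OF \<pi> \<rho>] \<epsilon> this]
    show ?thesis unfolding s_def by (intro finite_model_nat_copy[OF _ P E(2)]) auto
  qed
  have s0: "s p \<noteq> 0" if "p \<in> carrier P" "p \<noteq> \<one>\<^bsub>P\<^esub>" for p
    using r0 that by (simp add: s_def)
  obtain H :: "nat \<Rightarrow> nat monoid" and l \<Phi> \<phi> where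
    *: "ultrafilter_on UNIV \<Phi>"
      "\<forall>n. finite (carrier (H n)) \<and> invariant_length_function (H n) (l n) \<and>
             (\<forall>h\<in>carrier (H n). l n h \<le> 1)"
      "\<phi> \<in> mon P (metric_ultraproduct UNIV H l \<Phi>)"
    and norm: "\<forall>p\<in>carrier P. ultraproduct_norm l \<Phi> (\<phi> p) = s p"
    by (rule ultraproduct_of_finite_models[OF P cnt s0 s_models])
  have "kernel P Q \<pi> = {p \<in> carrier P. ultraproduct_norm l \<Phi> (\<phi> p) \<le> 1 / 2}"
    using norm rle by (auto simp: s_def kernel_def split: if_splits)
  then show ?thesis using that * by blast
qed

lemma countable_finitely_generated_group:
  assumes "finitely_generated_group G"
  shows "countable (carrier G)"
proof -
  obtain A where A: "finite A" "A \<subseteq> carrier G" "generate G A = carrier G" and G: "group G"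
    using assms by (auto simp: finitely_generated_group_def)
  interpret group G by fact
  have lists: "word_value G w \<in> carrier G" if "w \<in> lists (A \<times> UNIV)" for w
    using that A(2) by (induction w) auto
  have append: "word_value G (v @ w) = word_value G v \<otimes>\<^bsub>G\<^esub> word_value G w"
    if "v \<in> lists (A \<times> UNIV)" "w \<in> lists (A \<times> UNIV)" for v w
    using that(1)
  proof (induction v)
    case (Cons a v)
    then show ?case using A(2) lists[of v] lists[OF that(2)] by (cases a) (auto simp: m_assoc subset_iff)
  qed (use lists that(2) in simp)
  have "generate G A \<subseteq> word_value G ` lists (A \<times> UNIV)"
  proof
    fix g assume "g \<in> generate G A"
    then show "g \<in> word_value G ` lists (A \<times> UNIV)"
    proof induction
      case one
      then show ?case by (intro image_eqI[of _ _ "[]"]) auto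
    next
      case (incl h)
      then show ?case using A(2) by (intro image_eqI[of _ _ "[(h, True)]"]) auto
    next
      case (inv h)
      then show ?case using A(2) by (intro image_eqI[of _ _ "[(h, False)]"]) auto
    next
      case (eng g h)
      then obtain v w where "v \<in> lists (A \<times> UNIV)" "w \<in> lists (A \<times> UNIV)"
        "g = word_value G v" "h = word_value G w" by blast
      then show ?case using append by (intro image_eqI[of _ _ "v @ w"]) auto
    qed
  qed
  moreover have "countable (word_value G ` lists (A \<times> (UNIV :: bool set)))"
    using A(1) by (intro countable_image countable_lists countable_finite) auto
  ultimately show ?thesis using A(3) countable_subset by metis
qed

text \<open>
  The projection of \<open>F/N\<close> onto \<open>F/N1\<close> from the third isomorphism theorem.  The cosets of \<open>N\<close> in \<open>N1\<close>
  are literally cosets of \<open>N\<close> in \<open>F\<close>, so \<open>N1/N\<close> is the kernel as a set.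
\<close>

lemma factor_group_projection:
  assumes N: "N \<lhd> F" and N1: "N1 \<lhd> F" and sub: "N \<subseteq> N1"
  obtains \<pi> where "\<pi> \<in> hom (F Mod N) (F Mod N1)"
    and "kernel (F Mod N) (F Mod N1) \<pi> = carrier (F\<lparr>carrier := N1\<rparr> Mod N)"
proof -
  interpret N: normal N F by fact
  interpret N1: normal N1 F by fact
  interpret h: group_hom F "F Mod N1" "\<lambda>x. N1 #>\<^bsub>F\<^esub> x"
    using N1.r_coset_hom_Mod N1.factorgroup_is_group N.is_group
    by (simp add: group_hom_def group_hom_axioms_def)
  have mem: "N1 #>\<^bsub>F\<^esub> x = N1 \<longleftrightarrow> x \<in> N1" if "x \<in> carrier F" for x
    using that N.coset_join1 N.coset_join2 N1.subgroup_axioms by blast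
  have "N \<subseteq> kernel F (F Mod N1) (\<lambda>x. N1 #>\<^bsub>F\<^esub> x)"
    using sub N.subset mem by (auto simp: kernel_def FactGroup_def)
  then obtain \<pi> where \<pi>: "\<pi> \<in> hom (F Mod N) (F Mod N1)"
    "\<And>x. x \<in> carrier F \<Longrightarrow> \<pi> (N #>\<^bsub>F\<^esub> x) = N1 #>\<^bsub>F\<^esub> x"
    using h.FactGroup_universal_kernel[OF N] by blast
  have "kernel (F Mod N) (F Mod N1) \<pi> = carrier (F\<lparr>carrier := N1\<rparr> Mod N)"
  proof -
    have F_cosets: "carrier (F Mod N) = (\<lambda>x. N #>\<^bsub>F\<^esub> x) ` carrier F"
      by (auto simp: FactGroup_def RCOSETS_def)
    have N1_cosets: "carrier (F\<lparr>carrier := N1\<rparr> Mod N) = (\<lambda>x. N #>\<^bsub>F\<^esub> x) ` N1"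
      by (auto simp: FactGroup_def RCOSETS_def r_coset_def)
    have "\<pi> (N #>\<^bsub>F\<^esub> x) = \<one>\<^bsub>F Mod N1\<^esub> \<longleftrightarrow> x \<in> N1" if "x \<in> carrier F" for x
      using \<pi>(2)[OF that] mem[OF that] by (simp add: FactGroup_def)
    then show ?thesis
      unfolding kernel_def F_cosets N1_cosets using N1.subset by (auto intro!: imageI)
  qed
  then show ?thesis using \<pi>(1) that by blast
qed

theorem theorem4p2:
  fixes F :: "('a, 'b) monoid_scheme" and N N1 :: "'a set"
  assumes "free_group F" and "finitely_generated_group F"
    and "N \<lhd> F" and "N1 \<lhd> F" and "N \<subseteq> N1"
    and "weakly_sofic TYPE('i) TYPE('g) (F Mod N)"
    and "residually_finite (F Mod N1)"
  shows "\<exists>(I :: nat set) (H :: nat \<Rightarrow> nat monoid) l \<Phi> \<phi>.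
      ultrafilter_on I \<Phi> \<and>
      (\<forall>i\<in>I. finite (carrier (H i)) \<and> invariant_length_function (H i) (l i) \<and>
              (\<forall>h\<in>carrier (H i). l i h \<le> 1)) \<and>
      \<phi> \<in> mon (F Mod N) (metric_ultraproduct I H l \<Phi>) \<and>
      carrier (F\<lparr>carrier := N1\<rparr> Mod N) =
        {p \<in> carrier (F Mod N). ultraproduct_norm l \<Phi> (\<phi> p) \<le> 1 / 2}"
proof -
  have "carrier (F Mod N) = (\<lambda>x. N #>\<^bsub>F\<^esub> x) ` carrier F"
    by (auto simp: FactGroup_def RCOSETS_def)
  then have cnt: "countable (carrier (F Mod N))"
    using countable_finitely_generated_group[OF assms(2)] by simp
  obtain \<pi> where \<pi>: "\<pi> \<in> hom (F Mod N) (F Mod N1)"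
    and ker: "kernel (F Mod N) (F Mod N1) \<pi> = carrier (F\<lparr>carrier := N1\<rparr> Mod N)"
    using factor_group_projection[OF assms(3-5)] by blast
  obtain H :: "nat \<Rightarrow> nat monoid" and l \<Phi> \<phi> where
    "ultrafilter_on UNIV \<Phi>"
    "\<forall>n. finite (carrier (H n)) \<and> invariant_length_function (H n) (l n) \<and>
           (\<forall>h\<in>carrier (H n). l n h \<le> 1)"
    "\<phi> \<in> mon (F Mod N) (metric_ultraproduct UNIV H l \<Phi>)"
    "kernel (F Mod N) (F Mod N1) \<pi> = {p \<in> carrier (F Mod N). ultraproduct_norm l \<Phi> (\<phi> p) \<le> 1 / 2}"
    by (rule weakly_sofic_embedding_with_half_ball[OF assms(6) cnt assms(7) \<pi>])
  then show ?thesis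
    unfolding ker by (intro exI[of _ UNIV] exI[of _ H] exI[of _ l] exI[of _ \<Phi>] exI[of _ \<phi>]) simp
qed

end
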